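(* Let $M$ be a monoid such that $M$ is contained in $\operatorname{var}(L_\ell^1)$ for some $\ell\ge 5$ and $\operatorname{var}(M)$ contains $L_5^1=\langle a,b,1\mid aa=a,\ bb=b,\ ababa=0\rangle$. Then $M$ is non-finitely based.
   Context: For $\ell\ge 2$, $L_\ell=\langle a,b\mid aa=a,\ bb=b,\ \underbrace{ababab\cdots}_{\text{length }\ell}=0\rangle$ is the semigroup with zero $0$ generated by two idempotents $a,b$ subject to the relation that the alternating word $abab\cdots$ of length $\ell$ equals $0$; $L_\ell^1$ is the monoid obtained by adjoining an identity element $1$ to $L_\ell$. Monoids are regarded as semigroups, and $\operatorname{var}S$ denotes the variety of semigroups generated by $S$. A semigroup is finitely based if all its identities can be deduced from a finite subset of its identities, and non-finitely based otherwise. *)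

theory Defs
  imports "HOL-Algebra.Group"
begin

section \<open>Semigroups, identities and varieties\<close>

text \<open>
  Semigroups are carried by the records of \<^theory>\<open>HOL-Algebra.Group\<close>, of which only the
  fields \<^const>\<open>carrier\<close> and \<^const>\<open>mult\<close> are used below.  In this sense
  a monoid is regarded as a semigroup: its identity element takes no part in identities,
  varieties or bases.
\<close>

definition is_semigroup :: "('a, 'm) monoid_scheme \<Rightarrow> bool" where
  "is_semigroup S \<longleftrightarrow>
     (\<forall>x\<in>carrier S. \<forall>y\<in>carrier S. x \<otimes>\<^bsub>S\<^esub> y \<in> carrier S) \<and>
     (\<forall>x\<in>carrier S. \<forall>y\<in>carrier S. \<forall>z\<in>carrier S.
        (x \<otimes>\<^bsub>S\<^esub> y) \<otimes>\<^bsub>S\<^esub> z = x \<otimes>\<^bsub>S\<^esub> (y \<otimes>\<^bsub>S\<^esub> z))"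

text \<open>
  The free semigroup over an alphabet consists of the nonempty lists of letters.
  Since every identity involves finitely many letters, the countable alphabet
  \<^typ>\<open>nat\<close> is enough for identities.
\<close>

fun eval :: "('a, 'm) monoid_scheme \<Rightarrow> ('x \<Rightarrow> 'a) \<Rightarrow> 'x list \<Rightarrow> 'a" where
  "eval S \<phi> [] = undefined"
| "eval S \<phi> [x] = \<phi> x"
| "eval S \<phi> (x # y # w) = \<phi> x \<otimes>\<^bsub>S\<^esub> eval S \<phi> (y # w)"

type_synonym identity = "nat list \<times> nat list"

definition identities :: "identity set" where
  "identities = {(u, v). u \<noteq> [] \<and> v \<noteq> []}"

definition satisfies :: "('a, 'm) monoid_scheme \<Rightarrow> identity \<Rightarrow> bool" where
  "satisfies S e \<longleftrightarrow> (\<forall>\<phi> \<in> UNIV \<rightarrow> carrier S. eval S \<phi> (fst e) = eval S \<phi> (snd e))"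

definition identities_of :: "('a, 'm) monoid_scheme \<Rightarrow> identity set" where
  "identities_of S = {e \<in> identities. satisfies S e}"

definition equational_class :: "identity set \<Rightarrow> ('a, 'm) monoid_scheme set" where
  "equational_class \<Sigma> = {S. is_semigroup S \<and> (\<forall>e\<in>\<Sigma>. satisfies S e)}"

text \<open>
  The variety generated by \<open>S\<close> is the smallest equational class containing \<open>S\<close>.  Its members
  may live on any type.  Theorem \<open>var_iff_HSP\<close> below shows that it
  consists of the homomorphic images of subsemigroups of direct powers of \<open>S\<close>.
\<close>

definition var :: "('a, 'm) monoid_scheme \<Rightarrow> ('b, 'n) monoid_scheme set" where
  "var S = {T. \<forall>\<Sigma> \<subseteq> identities. S \<in> equational_class \<Sigma> \<longrightarrow> T \<in> equational_class \<Sigma>}"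

section \<open>Finite bases\<close>

inductive deducible :: "identity set \<Rightarrow> nat list \<Rightarrow> nat list \<Rightarrow> bool" for \<Sigma> where
  axiom: "(u, v) \<in> \<Sigma> \<Longrightarrow> deducible \<Sigma> u v"
| refl: "u \<noteq> [] \<Longrightarrow> deducible \<Sigma> u u"
| sym: "deducible \<Sigma> u v \<Longrightarrow> deducible \<Sigma> v u"
| trans: "deducible \<Sigma> u v \<Longrightarrow> deducible \<Sigma> v w \<Longrightarrow> deducible \<Sigma> u w"
| mult: "deducible \<Sigma> u v \<Longrightarrow> deducible \<Sigma> u' v' \<Longrightarrow> deducible \<Sigma> (u @ u') (v @ v')"
| subst: "deducible \<Sigma> u v \<Longrightarrow> (\<And>x. \<theta> x \<noteq> []) \<Longrightarrow>
    deducible \<Sigma> (concat (map \<theta> u)) (concat (map \<theta> v))"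

definition finitely_based :: "('a, 'm) monoid_scheme \<Rightarrow> bool" where
  "finitely_based S \<longleftrightarrow>
     (\<exists>\<Sigma> \<subseteq> identities_of S. finite \<Sigma> \<and> (\<forall>(u, v) \<in> identities_of S. deducible \<Sigma> u v))"

section \<open>The semigroups \<open>L\<^sub>\<ell>\<close> and the monoids \<open>L\<^sub>\<ell>\<^sup>1\<close>\<close>

datatype letter = A | B

text \<open>
  The free semigroup with zero on \<open>{a, b}\<close>: \<^term>\<open>Some w\<close> with \<^term>\<open>w \<noteq> []\<close> is a word,
  \<^term>\<open>None\<close> is the zero.
\<close>

definition free0 :: "letter list option set" where
  "free0 = insert None (Some ` {w. w \<noteq> []})"

fun mult0 :: "letter list option \<Rightarrow> letter list option \<Rightarrow> letter list option" where
  "mult0 (Some u) (Some v) = Some (u @ v)"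
| "mult0 _ _ = None"

definition alternating :: "nat \<Rightarrow> letter list" where
  "alternating l = map (\<lambda>i. if even i then A else B) [0..<l]"

text \<open>The least congruence on the free semigroup with zero containing the defining relations.\<close>

inductive_set L_cong :: "nat \<Rightarrow> (letter list option \<times> letter list option) set" for l where
  aa: "(Some [A, A], Some [A]) \<in> L_cong l"
| bb: "(Some [B, B], Some [B]) \<in> L_cong l"
| zero: "(Some (alternating l), None) \<in> L_cong l"
| refl: "x \<in> free0 \<Longrightarrow> (x, x) \<in> L_cong l"
| sym: "(x, y) \<in> L_cong l \<Longrightarrow> (y, x) \<in> L_cong l"
| trans: "(x, y) \<in> L_cong l \<Longrightarrow> (y, z) \<in> L_cong l \<Longrightarrow> (x, z) \<in> L_cong l"
| mult: "(x, y) \<in> L_cong l \<Longrightarrow> (x', y') \<in> L_cong l \<Longrightarrow> (mult0 x x', mult0 y y') \<in> L_cong l"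

definition L_carrier :: "nat \<Rightarrow> letter list option set set" where
  "L_carrier l = free0 // L_cong l"

definition L_mult ::
  "nat \<Rightarrow> letter list option set \<Rightarrow> letter list option set \<Rightarrow> letter list option set" where
  "L_mult l X Y = (\<Union>x\<in>X. \<Union>y\<in>Y. L_cong l `` {mult0 x y})"

text \<open>The monoid \<open>L\<^sub>\<ell>\<^sup>1\<close>; the adjoined identity element is \<^term>\<open>None\<close>.\<close>

fun adjoin1_mult :: "('a \<Rightarrow> 'a \<Rightarrow> 'a) \<Rightarrow> 'a option \<Rightarrow> 'a option \<Rightarrow> 'a option" where
  "adjoin1_mult f None y = y"
| "adjoin1_mult f x None = x"
| "adjoin1_mult f (Some x) (Some y) = Some (f x y)"

definition L1 :: "nat \<Rightarrow> letter list option set option monoid" where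
  "L1 l = \<lparr>carrier = insert None (Some ` L_carrier l),
           mult = adjoin1_mult (L_mult l), one = None\<rparr>"

section \<open>Basic facts\<close>

lemma monoid_is_semigroup: "monoid M \<Longrightarrow> is_semigroup M"
  by (simp add: is_semigroup_def monoid.m_closed monoid.m_assoc)

lemma mult0_assoc: "mult0 (mult0 x y) z = mult0 x (mult0 y z)"
  by (cases x; cases y; cases z) auto

lemma mult0_closed: "x \<in> free0 \<Longrightarrow> y \<in> free0 \<Longrightarrow> mult0 x y \<in> free0"
  by (auto simp: free0_def)

lemma L_cong_free0:
  assumes "0 < l" "(x, y) \<in> L_cong l" shows "x \<in> free0 \<and> y \<in> free0"
  using assms(2)
proof induction
  case (mult x y x' y') then show ?case by (simp add: mult0_closed)
qed (use assms(1) in \<open>auto simp: free0_def alternating_def\<close>)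

lemma equiv_L_cong: "0 < l \<Longrightarrow> equiv free0 (L_cong l)"
  by (intro equivI refl_onI symI transI)
     (auto dest: L_cong_free0 intro: L_cong.refl L_cong.sym L_cong.trans)

lemma L_mult_class:
  assumes "0 < l" "x \<in> free0" "y \<in> free0"
  shows "L_mult l (L_cong l `` {x}) (L_cong l `` {y}) = L_cong l `` {mult0 x y}"
proof -
  have "L_cong l `` {mult0 x' y'} = L_cong l `` {mult0 x y}"
    if "(x, x') \<in> L_cong l" "(y, y') \<in> L_cong l" for x' y'
    using equiv_class_eq[OF equiv_L_cong[OF assms(1)] L_cong.mult[OF that]] by simp
  moreover have "(x, x) \<in> L_cong l" "(y, y) \<in> L_cong l"
    using assms by (auto intro: L_cong.refl)
  ultimately show ?thesis
    unfolding L_mult_def by blast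
qed

lemma monoid_L1:
  assumes "0 < l" shows "monoid (L1 l)"
proof -
  have closed: "L_mult l X Y \<in> L_carrier l" if "X \<in> L_carrier l" "Y \<in> L_carrier l" for X Y
    using that unfolding L_carrier_def
    by (auto elim!: quotientE simp: L_mult_class[OF assms] intro!: quotientI mult0_closed)
  have assoc: "L_mult l (L_mult l X Y) Z = L_mult l X (L_mult l Y Z)"
    if "X \<in> L_carrier l" "Y \<in> L_carrier l" "Z \<in> L_carrier l" for X Y Z
    using that unfolding L_carrier_def
    by (auto elim!: quotientE simp: L_mult_class[OF assms] mult0_closed mult0_assoc)
  show ?thesis
    by (rule monoidI) (auto simp: L1_def closed assoc)
qed

lemma eval_Cons: "w \<noteq> [] \<Longrightarrow> eval S \<phi> (x # w) = \<phi> x \<otimes>\<^bsub>S\<^esub> eval S \<phi> w"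
  by (cases w) auto

lemma eval_map: "w \<noteq> [] \<Longrightarrow> eval S \<phi> (map r w) = eval S (\<phi> \<circ> r) w"
  by (induction w rule: list_nonempty_induct) (auto simp: eval_Cons)

lemma eval_cong:
  "w \<noteq> [] \<Longrightarrow> (\<And>x. x \<in> set w \<Longrightarrow> \<phi> x = \<psi> x) \<Longrightarrow> eval S \<phi> w = eval S \<psi> w"
  by (induction w rule: list_nonempty_induct) (auto simp: eval_Cons)

lemma eval_closed:
  assumes S: "is_semigroup S" and "w \<noteq> []" "\<phi> ` set w \<subseteq> carrier S"
  shows "eval S \<phi> w \<in> carrier S"
  using assms(2,3)
  by (induction w rule: list_nonempty_induct) (use S in \<open>auto simp: eval_Cons is_semigroup_def\<close>)

lemma eval_append:
  assumes S: "is_semigroup S" and "u \<noteq> []" "v \<noteq> []" "\<phi> ` set (u @ v) \<subseteq> carrier S"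
  shows "eval S \<phi> (u @ v) = eval S \<phi> u \<otimes>\<^bsub>S\<^esub> eval S \<phi> v"
  using assms(2,4)
proof (induction u rule: list_nonempty_induct)
  case (single x) then show ?case using assms(3) by (simp add: eval_Cons)
next
  case (cons x u)
  have "eval S \<phi> u \<in> carrier S" "eval S \<phi> v \<in> carrier S"
    using cons S assms(3) by (auto intro!: eval_closed)
  then show ?case using cons S by (auto simp: eval_Cons is_semigroup_def)
qed

text \<open>
  Birkhoff's theorem.  The exponent \<open>I\<close> of the direct power can always be taken to be a
  set of maps from \<open>T\<close> to \<open>S\<close>.
\<close>

theorem var_iff_HSP:
  fixes S :: "('a, 'm) monoid_scheme" and T :: "('b, 'n) monoid_scheme"
  assumes S: "is_semigroup S"
  shows "T \<in> var S \<longleftrightarrow> is_semigroup T \<and>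
    (\<exists>(I :: ('b \<Rightarrow> 'a) set) C h.
       C \<subseteq> (I \<rightarrow>\<^sub>E carrier S) \<and>
       (\<forall>f\<in>C. \<forall>g\<in>C. (\<lambda>i\<in>I. f i \<otimes>\<^bsub>S\<^esub> g i) \<in> C) \<and>
       h ` C = carrier T \<and>
       (\<forall>f\<in>C. \<forall>g\<in>C. h (\<lambda>i\<in>I. f i \<otimes>\<^bsub>S\<^esub> g i) = h f \<otimes>\<^bsub>T\<^esub> h g))"
    (is "_ \<longleftrightarrow> _ \<and> ?HSP")
proof (intro iffI conjI)
  assume T: "T \<in> var S"
  have "S \<in> equational_class {}" using S by (simp add: equational_class_def)
  with T show sgT: "is_semigroup T" by (force simp: var_def equational_class_def)
  have sat: "satisfies T (u, v)" if "u \<noteq> []" "v \<noteq> []" "satisfies S (u, v)" for u v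
  proof -
    have "{(u, v)} \<subseteq> identities" "S \<in> equational_class {(u, v)}"
      using that S by (auto simp: identities_def equational_class_def)
    then have "T \<in> equational_class {(u, v)}" using T unfolding var_def by blast
    then show ?thesis by (simp add: equational_class_def)
  qed
  define I where "I = (UNIV :: 'b set) \<rightarrow> carrier S"
  define W where "W = {w. w \<noteq> [] \<and> set w \<subseteq> carrier T}"
  define F where "F w = (\<lambda>\<phi>\<in>I. eval S \<phi> w)" for w
  define h where "h f = eval T id (SOME w. w \<in> W \<and> F w = f)" for f
  have wd: "eval T id w = eval T id w'" if w: "w \<in> W" "w' \<in> W" "F w = F w'" for w w'
  proof -
    obtain r :: "'b \<Rightarrow> nat" where r: "inj_on r (set (w @ w'))"
      using finite_imp_inj_to_nat_seg[of "set (w @ w')"] by auto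
    have ne: "w \<noteq> []" "w' \<noteq> []" using w by (auto simp: W_def)
    have "satisfies S (map r w, map r w')"
      unfolding satisfies_def
    proof
      fix \<phi> :: "nat \<Rightarrow> 'a" assume "\<phi> \<in> UNIV \<rightarrow> carrier S"
      then have "\<phi> \<circ> r \<in> I" by (auto simp: I_def)
      then have "eval S (\<phi> \<circ> r) w = eval S (\<phi> \<circ> r) w'"
        using fun_cong[OF w(3), of "\<phi> \<circ> r"] by (simp add: F_def)
      then show "eval S \<phi> (fst (map r w, map r w')) = eval S \<phi> (snd (map r w, map r w'))"
        using ne by (simp add: eval_map)
    qed
    then have sT: "satisfies T (map r w, map r w')" using ne by (intro sat) auto
    define g where
      "g n = (if n \<in> r ` set (w @ w') then inv_into (set (w @ w')) r n else hd w)" for n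
    have g: "g (r x) = x" if "x \<in> set (w @ w')" for x
      using that r by (simp add: g_def)
    have "g n \<in> carrier T" for n
    proof (cases "n \<in> r ` set (w @ w')")
      case True
      then show ?thesis using g w by (auto simp: W_def)
    next
      case False
      then show ?thesis using w ne by (auto simp: g_def W_def)
    qed
    then have "eval T g (map r w) = eval T g (map r w')"
      using sT by (auto simp: satisfies_def)
    moreover have "eval T (g \<circ> r) w = eval T id w" "eval T (g \<circ> r) w' = eval T id w'"
      using ne g by (auto intro!: eval_cong)
    ultimately show ?thesis using ne by (simp add: eval_map)
  qed
  have hF: "h (F w) = eval T id w" if "w \<in> W" for w
    unfolding h_def by (rule someI2[where a = w]) (simp add: that, blast intro: wd that)
  have appW: "w @ w' \<in> W" if "w \<in> W" "w' \<in> W" for w w'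
    using that by (auto simp: W_def)
  have FF: "(\<lambda>i\<in>I. F w i \<otimes>\<^bsub>S\<^esub> F w' i) = F (w @ w')" if "w \<in> W" "w' \<in> W" for w w'
  proof
    fix i show "(\<lambda>i\<in>I. F w i \<otimes>\<^bsub>S\<^esub> F w' i) i = F (w @ w') i"
    proof (cases "i \<in> I")
      case True
      then have "i ` set (w @ w') \<subseteq> carrier S" by (auto simp: I_def)
      then show ?thesis using True that by (simp add: F_def W_def eval_append[OF S])
    qed (simp add: F_def)
  qed
  have hom: "h (F (w @ w')) = h (F w) \<otimes>\<^bsub>T\<^esub> h (F w')" if "w \<in> W" "w' \<in> W" for w w'
    using that appW[OF that] by (simp add: hF) (subst eval_append[OF sgT]; auto simp: W_def)
  have "F ` W \<subseteq> (I \<rightarrow>\<^sub>E carrier S)"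
  proof
    fix f assume "f \<in> F ` W"
    then obtain w where w: "w \<in> W" "f = F w" by blast
    have "eval S \<phi> w \<in> carrier S" if "\<phi> \<in> I" for \<phi>
      using that w by (intro eval_closed[OF S]) (auto simp: I_def W_def)
    then show "f \<in> I \<rightarrow>\<^sub>E carrier S" using w by (auto simp: F_def)
  qed
  moreover have "\<forall>f\<in>F ` W. \<forall>g\<in>F ` W. (\<lambda>i\<in>I. f i \<otimes>\<^bsub>S\<^esub> g i) \<in> F ` W"
    by (auto simp: FF appW)
  moreover have "h ` F ` W = carrier T"
  proof
    show "h ` F ` W \<subseteq> carrier T"
    proof clarify
      fix w assume w: "w \<in> W"
      then have "w \<noteq> []" "id ` set w \<subseteq> carrier T" by (simp_all add: W_def)
      from eval_closed[OF sgT this] show "h (F w) \<in> carrier T" by (simp add: hF[OF w])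
    qed
    show "carrier T \<subseteq> h ` F ` W"
    proof
      fix t assume "t \<in> carrier T"
      then have "[t] \<in> W" by (simp add: W_def)
      moreover from this have "h (F [t]) = t" by (simp add: hF)
      ultimately show "t \<in> h ` F ` W" by force
    qed
  qed
  moreover have "\<forall>f\<in>F ` W. \<forall>g\<in>F ` W. h (\<lambda>i\<in>I. f i \<otimes>\<^bsub>S\<^esub> g i) = h f \<otimes>\<^bsub>T\<^esub> h g"
    by (auto simp: FF hom)
  ultimately show ?HSP by blast
next
  assume T: "is_semigroup T \<and> ?HSP"
  then have sgT: "is_semigroup T" ..
  from T obtain I :: "('b \<Rightarrow> 'a) set" and C h where HSP: "C \<subseteq> (I \<rightarrow>\<^sub>E carrier S) \<and>
      (\<forall>f\<in>C. \<forall>g\<in>C. (\<lambda>i\<in>I. f i \<otimes>\<^bsub>S\<^esub> g i) \<in> C) \<and> h ` C = carrier T \<and>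
      (\<forall>f\<in>C. \<forall>g\<in>C. h (\<lambda>i\<in>I. f i \<otimes>\<^bsub>S\<^esub> g i) = h f \<otimes>\<^bsub>T\<^esub> h g)"
    by (elim conjE exE) (rule that, intro conjI)
  then have C: "C \<subseteq> (I \<rightarrow>\<^sub>E carrier S)"
    and cl: "\<And>f g. f \<in> C \<Longrightarrow> g \<in> C \<Longrightarrow> (\<lambda>i\<in>I. f i \<otimes>\<^bsub>S\<^esub> g i) \<in> C"
    and onto: "h ` C = carrier T"
    and hom: "\<And>f g. f \<in> C \<Longrightarrow> g \<in> C \<Longrightarrow> h (\<lambda>i\<in>I. f i \<otimes>\<^bsub>S\<^esub> g i) = h f \<otimes>\<^bsub>T\<^esub> h g"
    by simp_all
  have "satisfies T (u, v)" if ne: "u \<noteq> []" "v \<noteq> []" and sat: "satisfies S (u, v)" for u v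
    unfolding satisfies_def
  proof
    fix \<phi> :: "nat \<Rightarrow> 'b" assume "\<phi> \<in> UNIV \<rightarrow> carrier T"
    then have "\<forall>n. \<exists>f. f \<in> C \<and> h f = \<phi> n" using onto by (metis Pi_iff UNIV_I image_iff)
    then obtain \<psi> where \<psi>: "\<And>n. \<psi> n \<in> C" "\<And>n. h (\<psi> n) = \<phi> n" by metis
    have key: "(\<lambda>i\<in>I. eval S (\<lambda>n. \<psi> n i) w) \<in> C \<and>
        h (\<lambda>i\<in>I. eval S (\<lambda>n. \<psi> n i) w) = eval T \<phi> w" if "w \<noteq> []" for w
      using that
    proof (induction w rule: list_nonempty_induct)
      case (single x)
      have "(\<lambda>i\<in>I. \<psi> x i) = \<psi> x" using \<psi>(1)[of x] C by (intro PiE_restrict) auto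
      then show ?case using \<psi> by simp
    next
      case (cons x w)
      let ?f = "\<lambda>i\<in>I. eval S (\<lambda>n. \<psi> n i) w"
      have f: "?f \<in> C" "h ?f = eval T \<phi> w" using cons by blast+
      have "(\<lambda>i\<in>I. eval S (\<lambda>n. \<psi> n i) (x # w)) = (\<lambda>i\<in>I. \<psi> x i \<otimes>\<^bsub>S\<^esub> ?f i)"
        using cons by (intro restrict_ext) (simp add: eval_Cons)
      with cl[OF \<psi>(1) f(1), of x] hom[OF \<psi>(1) f(1), of x] f(2) \<psi>(2)[of x]
      show ?case by (simp only: eval_Cons[OF cons(1), of T] simp_thms)
    qed
    have "(\<lambda>n. \<psi> n i) \<in> UNIV \<rightarrow> carrier S" if "i \<in> I" for i
      using \<psi>(1) C that by (auto simp: PiE_iff subset_iff)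
    then have "(\<lambda>i\<in>I. eval S (\<lambda>n. \<psi> n i) u) = (\<lambda>i\<in>I. eval S (\<lambda>n. \<psi> n i) v)"
      using sat by (auto simp: satisfies_def)
    then show "eval T \<phi> (fst (u, v)) = eval T \<phi> (snd (u, v))"
      using key[OF ne(1)] key[OF ne(2)] by simp
  qed
  then show "T \<in> var S"
    using sgT unfolding var_def equational_class_def identities_def by auto
qed

end

theory Submission
  imports Defs
begin

text \<open>
  Evaluating the letters of a word at words over \<open>{A, B}\<close> gives a word over \<open>{A, B}\<close>.  Its value
  in \<open>L\<^sub>\<ell>\<close> is an alternating word, which is known from its first letter, its last letter and
  its number \<open>runs\<close> of maximal blocks of \<open>A\<close>s.  For \<open>\<ell> = 5\<close> the value is zero exactly
  when there are at least three such blocks.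

  Write \<open>x\<close> for the letter \<open>0\<close> and \<open>y\<^sub>j\<close> for the letter \<open>j\<close>.  The words
  \<open>U n = x y\<^sub>1 \<dots> y\<^sub>n \<cdot> x y\<^sub>1 x y\<^sub>2 \<dots> x y\<^sub>n \<cdot> x\<close>  and
  \<open>V n = x y\<^sub>1 x y\<^sub>2 \<dots> x y\<^sub>n \<cdot> x y\<^sub>1 \<dots> y\<^sub>n \<cdot> x\<close>
  have equal values in every \<open>L\<^sub>\<ell>\<^sup>1\<close> (\<open>L1_satisfies_U_V\<close>).  If \<open>x\<close> is evaluated at \<open>1\<close>,
  both become \<open>(y\<^sub>1 \<dots> y\<^sub>n)\<^sup>2\<close>.  Otherwise they are evaluated at \<open>g h x\<close> and \<open>h g x\<close>, where
  \<open>g\<close> and \<open>h\<close> begin with the first letter of \<open>x\<close>; the blocks that merge at the junctions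
  depend only on the last letters of \<open>g\<close> and \<open>h\<close>, so the two words have equally many blocks.

  On the other hand, an identity \<open>u = v\<close> of \<open>L\<^sub>5\<^sup>1\<close> with few letters compared to \<open>n\<close> cannot
  destroy the uninterrupted first copy of the \<open>y\<close>s in \<open>U n\<close> (\<open>U_like_step\<close>).  Suppose
  \<open>\<theta>(u)\<close> has the same values in \<open>L\<^sub>5\<^sup>1\<close> as \<open>U n\<close> and contains such a copy.  A new \<open>y\<close> starts at
  \<open>n - 1\<close> places within the copy, which are too many for all of them to be starts of images of
  letters of \<open>u\<close>.  So one of them, where \<open>y\<^sub>i\<close> is followed by \<open>y\<^sub>j\<close>, lies inside the
  image of a letter \<open>t\<close>.  The factor \<open>y\<^sub>i y\<^sub>j\<close> occurs only once in \<open>\<theta>(u)\<close>: the test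
  \<open>y\<^sub>i, y\<^sub>j \<mapsto> A\<close>, \<open>x \<mapsto> B\<close> gives three blocks on \<open>U n\<close>, so in \<open>\<theta>(u)\<close> too the second
  occurrences of \<open>y\<^sub>i\<close> and \<open>y\<^sub>j\<close> are separated.  Hence \<open>t\<close> occurs once in \<open>u\<close>, and the test
  \<open>t \<mapsto> AB\<close> shows that it occurs once in \<open>v\<close>.  Now any word over \<open>{A, B}\<close> can be inserted at the
  corresponding place of \<open>\<theta>(u)\<close> and \<open>\<theta>(v)\<close> as a marker.  The markers \<open>AB\<close>, \<open>BA\<close> and \<open>B\<close>
  show that in \<open>\<theta>(v)\<close> each \<open>y\<close> has an occurrence that no \<open>x\<close> separates from the marker
  (\<open>block_form_marker\<close>).  These occurrences form an uninterrupted first copy in \<open>\<theta>(v)\<close>.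

  Consequently, with a finite set of identities of \<open>M\<close> one can deduce from \<open>U n\<close>, for large
  \<open>n\<close>, only words with an uninterrupted first copy.  The word \<open>V n\<close> has none, although \<open>M\<close>
  satisfies \<open>U n = V n\<close>.
\<close>

section \<open>Maximal blocks in words over two letters\<close>

text \<open>Number of maximal blocks of \<^const>\<open>A\<close>s, counted at their right ends.\<close>

fun runs :: "letter list \<Rightarrow> nat" where
  "runs [] = 0"
| "runs [x] = (if x = A then 1 else 0)"
| "runs (x # y # w) = (if x = A \<and> y = B then 1 else 0) + runs (y # w)"

lemma runs_Cons:
  "runs (x # w) = runs w + (if x = A \<and> (w = [] \<or> hd w = B) then 1 else 0)"
  by (cases w) auto

lemma not_A: "x \<noteq> A \<longleftrightarrow> x = B" and not_B: "x \<noteq> B \<longleftrightarrow> x = A"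
  by (cases x; simp)+

lemma runs_append:
  assumes "u \<noteq> []" "v \<noteq> []"
  shows "runs (u @ v) + (if last u = A \<and> hd v = A then 1 else 0) = runs u + runs v"
  using assms(1)
proof (induction u rule: list_nonempty_induct)
  case (single x) then show ?case using assms(2) by (cases "hd v") (auto simp: runs_Cons)
next
  case (cons x u) then show ?case by (auto simp: runs_Cons)
qed

lemma runs_B [simp]: "runs (B # v) = runs v" "runs (u @ B # v) = runs u + runs v"
proof -
  show 1: "runs (B # v) = runs v" by (simp add: runs_Cons)
  show "runs (u @ B # v) = runs u + runs v"
    using runs_append[of u "B # v"] 1 by (cases "u = []") auto
qed

lemma runs_snoc_A: "runs (u @ [A]) = runs u + (if u \<noteq> [] \<and> last u = A then 0 else 1)"
  using runs_append[of u "[A]"] by (cases "u = []") (auto split: if_splits)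

lemma runs_pos: "0 < runs w \<longleftrightarrow> A \<in> set w"
proof (induction w)
  case (Cons x w) then show ?case by (cases x; cases w) (auto simp: runs_Cons not_A not_B)
qed simp

lemma runs_append_le: "runs (u @ v) \<le> runs u + runs v" "runs u \<le> runs (u @ v)" "runs v \<le> runs (u @ v)"
proof -
  have "(runs (u @ v) \<le> runs u + runs v) \<and> runs u \<le> runs (u @ v) \<and> runs v \<le> runs (u @ v)"
  proof (cases "u = [] \<or> v = []")
    case False
    then have "last u = A \<Longrightarrow> 0 < runs u" "hd v = A \<Longrightarrow> 0 < runs v"
      by (metis runs_pos last_in_set hd_in_set)+
    then show ?thesis using False runs_append[of u v] by (auto split: if_splits)
  qed auto
  then show "runs (u @ v) \<le> runs u + runs v" "runs u \<le> runs (u @ v)" "runs v \<le> runs (u @ v)"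
    by auto
qed

lemma runs_eq_0: "runs w = 0 \<longleftrightarrow> A \<notin> set w"
  using runs_pos[of w] by auto

lemma runs_only_A: "set w \<subseteq> {A} \<Longrightarrow> runs w = (if w = [] then 0 else 1)"
  by (induction w) (auto simp: runs_Cons dest: hd_in_set)

abbreviation subst :: "('a \<Rightarrow> 'b list) \<Rightarrow> 'a list \<Rightarrow> 'b list" where
  "subst f w \<equiv> concat (map f w)"

lemma subst_subst: "subst f (subst g w) = subst (\<lambda>z. subst f (g z)) w"
  by (induction w) auto

text \<open>Deleting \<^const>\<open>B\<close>s can merge blocks of \<^const>\<open>A\<close>s but never creates new ones.\<close>

lemma runs_delete:
  assumes "\<And>z. z \<in> set w \<Longrightarrow> f z = [h z] \<or> (f z = [] \<and> h z = B)"
  shows "runs (subst f w) \<le> runs (map h w)"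
  using assms
proof (induction w)
  case (Cons z w)
  have IH: "runs (subst f w) \<le> runs (map h w)" using Cons by simp
  have hd: "hd (subst f w) = A \<and> subst f w \<noteq> []" if "w \<noteq> []" "hd (map h w) = A"
    using that Cons.prems[of "hd w"] by (cases w) auto
  show ?case using Cons.prems[of z] IH hd by (auto simp: runs_Cons not_A not_B)
qed simp

section \<open>Values in the monoid with \<open>ababa = 0\<close>\<close>

text \<open>
  This encodes the value in \<open>L\<^sub>5\<^sup>1\<close> of a word over \<open>{A, B}\<close>: \<^const>\<open>None\<close> is the identity
  element, \<^term>\<open>Some None\<close> is zero, and a triple is a nonzero alternating word.
\<close>

definition trace :: "letter list \<Rightarrow> (letter \<times> letter \<times> nat) option option" where
  "trace w = (if w = [] then None
     else if 3 \<le> runs w then Some None else Some (Some (hd w, last w, runs w)))"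

lemma trace_append:
  assumes "trace u = trace u'" "trace v = trace v'"
  shows "trace (u @ v) = trace (u' @ v')"
proof (cases "u = [] \<or> v = [] \<or> u' = [] \<or> v' = []")
  case True then show ?thesis using assms by (auto simp: trace_def split: if_splits)
next
  case False
  then have ne: "u \<noteq> []" "v \<noteq> []" "u' \<noteq> []" "v' \<noteq> []" by auto
  show ?thesis
  proof (cases "3 \<le> runs u \<or> 3 \<le> runs v")
    case True
    then have "3 \<le> runs u' \<or> 3 \<le> runs v'" using assms ne by (auto simp: trace_def split: if_splits)
    then have "3 \<le> runs (u @ v)" "3 \<le> runs (u' @ v')"
      using True runs_append_le(2,3) le_trans by blast+
    then show ?thesis using ne by (simp add: trace_def)
  next
    case False
    then have "hd u = hd u' \<and> last u = last u' \<and> runs u = runs u'"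
      "hd v = hd v' \<and> last v = last v' \<and> runs v = runs v'"
      using assms ne by (auto simp: trace_def split: if_splits)
    moreover from this have "runs (u @ v) = runs (u' @ v')"
      using runs_append[OF ne(1,2)] runs_append[OF ne(3,4)] by (simp split: if_splits)
    ultimately show ?thesis using ne by (simp add: trace_def)
  qed
qed

lemma trace_eqD:
  assumes "trace u = trace v"
  shows "u = [] \<longleftrightarrow> v = []" "3 \<le> runs u \<longleftrightarrow> 3 \<le> runs v" "runs u \<le> 2 \<Longrightarrow> runs v = runs u"
    "runs u \<le> 2 \<Longrightarrow> hd v = hd u" "runs u \<le> 2 \<Longrightarrow> last v = last u"
  using assms by (auto simp: trace_def split: if_splits)

text \<open>Agreement in \<open>L\<^sub>5\<^sup>1\<close>; erasing a letter is its evaluation at the identity element.\<close>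

definition equal5 :: "nat list \<Rightarrow> nat list \<Rightarrow> bool" where
  "equal5 u v \<longleftrightarrow> (\<forall>f. trace (subst f u) = trace (subst f v))"

lemma equal5_sym: "equal5 u v \<Longrightarrow> equal5 v u"
  and equal5_trans: "equal5 u v \<Longrightarrow> equal5 v w \<Longrightarrow> equal5 u w"
  by (simp_all add: equal5_def)

lemma equal5_subst: "equal5 u v \<Longrightarrow> equal5 (subst \<theta> u) (subst \<theta> v)"
  by (simp add: equal5_def subst_subst)

lemma equal5_context: "equal5 u v \<Longrightarrow> equal5 (c @ u @ d) (c @ v @ d)"
  by (auto simp: equal5_def intro!: trace_append)

text \<open>
  Elements of \<open>L\<^sub>\<ell>\<^sup>1\<close> are represented by optional words, with the empty word for the adjoined
  identity element.  In this way \<^const>\<open>mult0\<close> induces the multiplication of the whole monoid.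
\<close>

definition element :: "nat \<Rightarrow> letter list option \<Rightarrow> letter list option set option" where
  "element l x = (if x = Some [] then None else Some (L_cong l `` {x}))"

lemma free0_iff: "x \<in> free0 \<longleftrightarrow> x \<noteq> Some []"
  by (cases x) (auto simp: free0_def)

lemma element_mult:
  assumes "0 < l"
  shows "element l (mult0 x y) = element l x \<otimes>\<^bsub>L1 l\<^esub> element l y"
  using L_mult_class[OF assms, of x y]
  by (cases x; cases y) (auto simp: element_def L1_def free0_iff)

lemma element_carrier: "element l x \<in> carrier (L1 l)"
  by (auto simp: element_def L1_def L_carrier_def free0_iff intro!: quotientI)

lemma carrier_element: "c \<in> carrier (L1 l) \<Longrightarrow> \<exists>x. c = element l x"
proof (cases c)
  case None then show ?thesis by (intro exI[of _ "Some []"]) (simp add: element_def)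
next
  case (Some C)
  assume "c \<in> carrier (L1 l)"
  with Some have "C \<in> free0 // L_cong l" by (auto simp: L1_def L_carrier_def)
  then obtain x where "x \<in> free0" "C = L_cong l `` {x}" by (rule quotientE)
  with Some show ?thesis by (intro exI[of _ x]) (simp add: element_def free0_iff)
qed

lemma eval_element:
  assumes "0 < l" "w \<noteq> []"
  shows "eval (L1 l) (\<lambda>z. element l (r z)) w = element l (foldr mult0 (map r w) (Some []))"
  using assms(2)
proof (induction w rule: list_nonempty_induct)
  case (single z) then show ?case by (cases "r z") auto
next
  case (cons z w) then show ?case by (simp add: eval_Cons element_mult[OF assms(1)])
qed

lemma foldr_mult0_Some: "foldr mult0 (map (\<lambda>z. Some (f z)) w) (Some []) = Some (subst f w)"
  by (induction w) auto

lemma foldr_mult0_None: "z \<in> set w \<Longrightarrow> r z = None \<Longrightarrow> foldr mult0 (map r w) (Some []) = None"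
  by (induction w) auto

lemma element_eq_iff:
  assumes "0 < l"
  shows "element l x = element l y \<longleftrightarrow> (x = Some [] \<and> y = Some []) \<or> (x, y) \<in> L_cong l"
proof -
  have "(x, y) \<in> L_cong l \<Longrightarrow> x \<noteq> Some [] \<and> y \<noteq> Some []"
    using L_cong_free0[OF assms] by (auto simp: free0_iff)
  then show ?thesis
    using eq_equiv_class_iff[OF equiv_L_cong[OF assms], of x y]
    by (auto simp: element_def free0_iff)
qed

fun trace0 :: "letter list option \<Rightarrow> (letter \<times> letter \<times> nat) option option" where
  "trace0 None = Some None"
| "trace0 (Some w) = trace w"

lemma trace0_mult_zero:
  "trace0 x = Some None \<or> trace0 y = Some None \<Longrightarrow> trace0 (mult0 x y) = Some None"
proof (cases x; cases y)
  fix u v assume "trace0 x = Some None \<or> trace0 y = Some None" "x = Some u" "y = Some v"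
  then show ?thesis
    using runs_append_le(2)[of u v] runs_append_le(3)[of v u] by (auto simp: trace_def split: if_splits)
qed auto

text \<open>
  Words with different traces have different values in \<open>L\<^sub>5\<close>.
  The relation \<open>ababa = 0\<close> is respected because
  \<open>ababa\<close> has three blocks of \<open>a\<close>s and the number of blocks of a factor is at most that of the
  whole word.
\<close>

lemma L_cong5_trace: "(x, y) \<in> L_cong 5 \<Longrightarrow> trace0 x = trace0 y"
proof (induction rule: L_cong.induct)
  case zero
  have "alternating 5 = [A, B, A, B, A]"
    by (simp add: alternating_def upt_conv_Cons)
  then show ?case by (simp add: trace_def)
next
  case (mult x y x' y')
  show ?case
  proof (cases "trace0 x = Some None \<or> trace0 x' = Some None")
    case True
    then show ?thesis using mult.IH trace0_mult_zero by metis
  next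
    case False
    then obtain u u' v v' where "x = Some u" "x' = Some u'" "y = Some v" "y' = Some v'"
      using mult.IH by (metis option.exhaust trace0.simps(1))
    then show ?thesis using mult.IH by (auto intro!: trace_append)
  qed
qed (auto simp: trace_def)

lemma satisfies_L1_5_imp_equal5:
  assumes "satisfies (L1 5) (u, v)" "u \<noteq> []" "v \<noteq> []"
  shows "equal5 u v"
  unfolding equal5_def
proof
  fix f
  have "element 5 (Some (subst f u)) = element 5 (Some (subst f v))"
  proof -
    have "(\<lambda>z. element 5 (Some (f z))) \<in> UNIV \<rightarrow> carrier (L1 5)" using element_carrier by blast
    then show ?thesis
      using assms(1) eval_element[of 5 u "\<lambda>z. Some (f z)"] eval_element[of 5 v "\<lambda>z. Some (f z)"] assms(2,3)
      by (simp add: satisfies_def foldr_mult0_Some Ball_def del: Pi_iff)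
  qed
  then show "trace (subst f u) = trace (subst f v)"
    using L_cong5_trace[of "Some (subst f u)" "Some (subst f v)"]
    by (metis element_eq_iff option.inject trace0.simps(2) zero_less_numeral)
qed

section \<open>Words with equal values in all the monoids\<close>

text \<open>
  The alternating word with first letter \<open>h\<close>, last letter \<open>e\<close> and \<open>r\<close> blocks of \<^const>\<open>A\<close>s.
  Without any \<^const>\<open>A\<close>, only \<^term>\<open>[B]\<close> is left.
\<close>

fun canon :: "letter \<Rightarrow> nat \<Rightarrow> letter \<Rightarrow> letter list" where
  "canon h 0 e = [B]"
| "canon h (Suc r) e = (if h = B then [B] else []) @ concat (replicate r [A, B]) @
     A # (if e = B then [B] else [])"

lemma L_cong_Cons: "w \<noteq> [] \<Longrightarrow> (Some w, Some w') \<in> L_cong l \<Longrightarrow> (Some (x # w), Some (x # w')) \<in> L_cong l"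
  using L_cong.mult[OF L_cong.refl[of "Some [x]" l]] by (fastforce simp: free0_iff)

lemma L_cong_double: "(Some (x # x # w), Some (x # w)) \<in> L_cong l"
proof (cases "w = []")
  case True then show ?thesis by (cases x) (auto intro: L_cong.aa L_cong.bb)
next
  case False
  have "(Some [x, x], Some [x]) \<in> L_cong l" by (cases x) (auto intro: L_cong.aa L_cong.bb)
  from L_cong.mult[OF this L_cong.refl[of "Some w"]] False show ?thesis by (simp add: free0_iff)
qed

lemma L_cong_canon: "w \<noteq> [] \<Longrightarrow> (Some w, Some (canon (hd w) (runs w) (last w))) \<in> L_cong l"
proof (induction w rule: list_nonempty_induct)
  case (single x) then show ?case by (cases x) (auto intro!: L_cong.refl simp: free0_iff)
next
  case (cons x w)
  let ?c = "canon (hd w) (runs w) (last w)"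
  have step: "(Some (x # w), Some (x # ?c)) \<in> L_cong l" using cons L_cong_Cons by blast
  have A: "runs w \<noteq> 0" if "hd w = A" using that cons(1) hd_in_set[of w] by (auto simp: runs_eq_0)
  have B: "last w = B" if "runs w = 0" using that cons(1) last_in_set[of w] by (cases "last w") (auto simp: runs_eq_0)
  show ?case
  proof (cases "x = hd w")
    case True
    have "\<exists>c. ?c = x # c" using True A by (cases x; cases "runs w"; cases "runs w - 1") auto
    then have "(Some (x # ?c), Some ?c) \<in> L_cong l" using L_cong_double by auto
    moreover have "canon x (runs (x # w)) (last (x # w)) = ?c"
      using True cons(1) by (auto simp: runs_Cons)
    ultimately show ?thesis using L_cong.trans[OF step] by simp
  next
    case False
    then have "canon x (runs (x # w)) (last (x # w)) = x # ?c"
      using cons(1) A B by (cases x; cases "hd w"; cases "runs w") (auto simp: runs_Cons)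
    then show ?thesis using step by simp
  qed
qed

lemma L_cong_if_same_runs:
  assumes "w \<noteq> []" "w' \<noteq> []" "hd w = hd w'" "last w = last w'" "runs w = runs w'"
  shows "(Some w, Some w') \<in> L_cong l"
  using L_cong_canon[OF assms(1), of l] L_cong_canon[OF assms(2), of l] assms(3-5)
  by (metis L_cong.sym L_cong.trans)

text \<open>
  On both sides the first two words are followed by the same letter, namely the first letter of
  \<open>x\<close>.  So the number of merged blocks is the same.
\<close>

lemma runs_commute:
  assumes "g \<noteq> []" "h \<noteq> []" "x \<noteq> []" "hd g = hd x" "hd h = hd x"
  shows "runs (g @ h @ x) = runs (h @ g @ x)"
  using runs_append[of g "h @ x"] runs_append[of h x] runs_append[of h "g @ x"] runs_append[of g x] assms
  by (auto split: if_splits)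

definition plain_copy :: "nat list \<Rightarrow> nat list" where
  "plain_copy ys = 0 # ys"

definition spaced_copy :: "nat list \<Rightarrow> nat list" where
  "spaced_copy ys = concat (map (\<lambda>y. [0, y]) ys)"

definition U :: "nat \<Rightarrow> nat list" where
  "U n = plain_copy [1..<Suc n] @ spaced_copy [1..<Suc n] @ [0]"

definition V :: "nat \<Rightarrow> nat list" where
  "V n = spaced_copy [1..<Suc n] @ plain_copy [1..<Suc n] @ [0]"

lemma subst_spaced_copy_empty: "f 0 = [] \<Longrightarrow> subst f (spaced_copy ys) = subst f ys"
  by (induction ys) (auto simp: spaced_copy_def)

text \<open>
  If \<open>0\<close> is evaluated at the identity element, both copies become the same word.  Otherwise the
  two copies begin with the same letter of \<open>{A, B}\<close> as the value of the final \<open>0\<close>, and commute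
  in front of it.
\<close>

lemma L1_satisfies_U_V:
  assumes "0 < l" "0 < n"
  shows "satisfies (L1 l) (U n, V n)"
  unfolding satisfies_def
proof
  fix \<phi> :: "nat \<Rightarrow> letter list option set option" assume "\<phi> \<in> UNIV \<rightarrow> carrier (L1 l)"
  then have "\<forall>z. \<exists>x. \<phi> z = element l x" using carrier_element by blast
  then obtain r where r: "\<phi> = (\<lambda>z. element l (r z))" by metis
  have set: "set (U n) = set (V n)" by (auto simp: U_def V_def)
  have ne: "U n \<noteq> []" "V n \<noteq> []" by (auto simp: U_def V_def)
  have "element l (foldr mult0 (map r (U n)) (Some [])) = element l (foldr mult0 (map r (V n)) (Some []))"
  proof (cases "\<exists>z\<in>set (U n). r z = None")
    case True then show ?thesis using foldr_mult0_None set by metis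
  next
    case False
    define f where "f z = the (r z)" for z
    have "map r w = map (\<lambda>z. Some (f z)) w" if "set w = set (U n)" for w
      using False that by (auto simp: f_def)
    then have fold: "foldr mult0 (map r w) (Some []) = Some (subst f w)" if "set w = set (U n)" for w
      using that foldr_mult0_Some by metis
    define g h x where ghx: "g = subst f (plain_copy [1..<Suc n])" "h = subst f (spaced_copy [1..<Suc n])" "x = f 0"
    have U: "subst f (U n) = g @ h @ x" and V: "subst f (V n) = h @ g @ x"
      by (simp_all add: U_def V_def ghx)
    show ?thesis
    proof (cases "x = []")
      case True
      then have "g = h" using subst_spaced_copy_empty[of f] by (simp add: ghx plain_copy_def)
      then show ?thesis using fold set U V by simp
    next
      case False
      have "[1..<Suc n] = 1 # [2..<Suc n]" using assms(2) upt_conv_Cons[of 1 "Suc n"]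
        by (simp add: numeral_2_eq_2 del: upt_Suc)
      then have "g \<noteq> []" "h \<noteq> []" "hd g = hd x" "hd h = hd x"
        using False by (auto simp: ghx plain_copy_def spaced_copy_def simp del: upt_Suc)
      then have "(Some (subst f (U n)), Some (subst f (V n))) \<in> L_cong l"
        unfolding U V using False by (intro L_cong_if_same_runs runs_commute) auto
      then show ?thesis using fold set by (simp add: element_eq_iff[OF assms(1)])
    qed
  qed
  then show "eval (L1 l) \<phi> (fst (U n, V n)) = eval (L1 l) \<phi> (snd (U n, V n))"
    by (simp add: r eval_element[OF assms(1)] ne)
qed


section \<open>Tests on words with the values of \<open>U n\<close>\<close>

lemma runs_prefix_B: "set p \<subseteq> {B} \<Longrightarrow> runs (p @ w) = runs w"
  by (induction p) auto

lemma set_U: "set (U n) = {0..n}"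
  by (auto simp: U_def plain_copy_def spaced_copy_def)

lemma runs_subst_U:
  assumes "f 0 = [B]"
  shows "runs (subst f (U n)) = runs (subst f [1..<Suc n]) + (\<Sum>y\<leftarrow>[1..<Suc n]. runs (f y))"
proof -
  have "runs (p @ subst f (spaced_copy ys) @ [B]) = runs p + (\<Sum>y\<leftarrow>ys. runs (f y))" for p ys
    by (induction ys arbitrary: p) (simp_all add: spaced_copy_def assms)
  then show ?thesis by (simp add: U_def plain_copy_def assms del: upt_Suc)
qed

text \<open>
  Three families of tests: \<open>mark J\<close> looks only at how \<open>0\<close> separates the letters of \<open>J\<close>,
  \<open>erase_others j\<close> only at the letter \<open>j\<close>, and \<open>single_out j\<close> at how all other letters
  separate the occurrences of \<open>j\<close>.
\<close>

definition mark :: "nat set \<Rightarrow> nat \<Rightarrow> letter list" where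
  "mark J z = (if z \<in> J then [A] else if z = 0 then [B] else [])"

definition erase_others :: "nat \<Rightarrow> nat \<Rightarrow> letter list" where
  "erase_others j z = (if z = j then [A] else [])"

lemma mark_simps [simp]: "z \<in> J \<Longrightarrow> mark J z = [A]" "0 \<notin> J \<Longrightarrow> mark J 0 = [B]"
  by (simp_all add: mark_def)

abbreviation single_out :: "nat \<Rightarrow> nat \<Rightarrow> letter" where
  "single_out j z \<equiv> (if z = j then A else B)"

lemma subst_singleton: "subst (\<lambda>z. [h z]) w = map h w"
  by (induction w) auto

lemma sum_list_indicator: "distinct ys \<Longrightarrow> (\<Sum>y\<leftarrow>ys. if y \<in> J then 1 else 0) = card (set ys \<inter> J)"
  by (induction ys) (auto simp: Int_insert_left)

lemma A_in_mark: "A \<in> set (subst (mark J) w) \<longleftrightarrow> set w \<inter> J \<noteq> {}"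
  by (induction w) (auto simp: mark_def)

lemma mark_only_B: "set w \<inter> J = {} \<Longrightarrow> set (subst (mark J) w) \<subseteq> {B}"
  by (induction w) (auto simp: mark_def)

lemma mark_only_A: "0 \<notin> set w \<Longrightarrow> set (subst (mark J) w) \<subseteq> {A}"
  by (induction w) (auto simp: mark_def)

lemma erase_others_eq_Nil: "subst (erase_others j) w = [] \<longleftrightarrow> j \<notin> set w"
  by (induction w) (simp_all add: erase_others_def)

lemma erase_others_only_A: "set (subst (erase_others j) w) \<subseteq> {A}"
  by (auto simp: erase_others_def split: if_splits)

lemma runs_erase_others: "runs (subst (erase_others j) w) = (if j \<in> set w then 1 else 0)"
  unfolding runs_only_A[OF erase_others_only_A] erase_others_eq_Nil by simp

lemma hd_erase_others:
  assumes "hd (subst (erase_others j) w @ B # v) = B"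
  shows "j \<notin> set w"
proof (cases "subst (erase_others j) w")
  case Nil
  then show ?thesis unfolding erase_others_eq_Nil .
next
  case (Cons x xs)
  with erase_others_only_A[of j w] have "x = A" by (simp only: list.set insert_subset singleton_iff)
  then show ?thesis using assms Cons by (simp only: append_Cons list.sel letter.distinct)
qed

lemma last_Cons_B: "last (B # w) = A \<Longrightarrow> A \<in> set w"
  using last_in_set[of w] by (cases "w = []") auto

lemma hd_append_B: "hd (u @ B # v) = A \<Longrightarrow> A \<in> set u"
  by (cases u) auto

lemma runs_mark_no_zero: "0 \<notin> set w \<Longrightarrow> runs (subst (mark J) w) = (if set w \<inter> J = {} then 0 else 1)"
  by (subst runs_only_A) (auto simp: mark_def split: if_splits)

text \<open>
  The first copy contributes one block, and in the second copy \<open>0\<close> separates the letters of \<open>J\<close>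
  from each other.
\<close>

lemma runs_mark_U:
  assumes "J \<subseteq> {1..n}" "J \<noteq> {}"
  shows "runs (subst (mark J) (U n)) = Suc (card J)"
proof -
  have "(\<Sum>y\<leftarrow>[1..<Suc n]. runs (mark J y)) = (\<Sum>y\<leftarrow>[1..<Suc n]. if y \<in> J then 1 else 0)"
    by (intro arg_cong[of _ _ sum_list] map_cong) (auto simp: mark_def simp del: upt_Suc)
  moreover have "set [1..<Suc n] \<inter> J = J" using assms by auto
  moreover have "0 \<notin> J" using assms by auto
  ultimately show ?thesis
    using assms by (simp add: runs_subst_U runs_mark_no_zero sum_list_indicator del: upt_Suc)
qed

lemma runs_single_out_U:
  assumes "j \<in> {1..n}"
  shows "runs (map (single_out j) (U n)) = 2"
proof -
  have "(\<Sum>y\<leftarrow>[1..<Suc n]. runs [single_out j y]) = (\<Sum>y\<leftarrow>[1..<Suc n]. if y \<in> {j} then 1 else 0)"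
    by (intro arg_cong[of _ _ sum_list] map_cong) (auto simp del: upt_Suc)
  moreover have "set [1..<Suc n] \<inter> {j} = {j}" using assms by auto
  moreover have "runs (map (single_out j) [1..<Suc n]) = 1"
  proof -
    obtain ys zs where yz: "[1..<Suc n] = ys @ j # zs"
      using assms split_list[of j "[1..<Suc n]"] by (auto simp del: upt_Suc)
    moreover have "distinct [1..<Suc n]" by simp
    ultimately have "j \<notin> set ys" "j \<notin> set zs" by (auto simp del: upt_Suc distinct_upt)
    then have B: "set (map (single_out j) ys) \<subseteq> {B}" "set (map (single_out j) zs) \<subseteq> {B}" by auto
    have "runs (A # map (single_out j) zs) = 1"
      using runs_prefix_B[OF B(2), of "[]"] \<open>j \<notin> set zs\<close> by (cases zs) (auto simp: runs_Cons)
    then have "runs (map (single_out j) ys @ A # map (single_out j) zs) = 1"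
      using runs_prefix_B[OF B(1)] by simp
    moreover have "map (single_out j) [1..<Suc n] = map (single_out j) ys @ A # map (single_out j) zs"
      unfolding yz by simp
    ultimately show ?thesis by (simp only:)
  qed
  ultimately show ?thesis
    using runs_subst_U[of "\<lambda>z. [single_out j z]" n] assms sum_list_indicator[of "[1..<Suc n]" "{j}"]
    by (simp add: subst_singleton del: upt_Suc)
qed

lemma equal5D:
  assumes "equal5 u v"
  shows "trace (subst f u) = trace (subst f v)" "trace (map h u) = trace (map h v)"
  using assms subst_singleton unfolding equal5_def by metis+

lemma equal5_set: assumes "equal5 u v" shows "set u = set v"
proof (rule Set.set_eqI)
  fix c
  show "c \<in> set u \<longleftrightarrow> c \<in> set v"
    using trace_eqD(1)[OF equal5D(1)[OF assms, of "\<lambda>z. if z = c then [A] else []"]]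
    by (auto split: if_splits)
qed

text \<open>
  All tests with at most two blocks give the same result on \<open>W\<close> as on \<open>U n\<close>, because their
  value in \<open>L\<^sub>5\<^sup>1\<close> is not zero; a test with three blocks still has at least three.
\<close>

lemma equal5_U:
  assumes "equal5 W (U n)"
  shows "j \<in> {1..n} \<Longrightarrow> runs (subst (mark {j}) W) = 2"
    and "j \<in> {1..n} \<Longrightarrow> runs (map (single_out j) W) = 2"
    and "a \<in> {1..n} \<Longrightarrow> b \<in> {1..n} \<Longrightarrow> a \<noteq> b \<Longrightarrow> 3 \<le> runs (subst (mark {a, b}) W)"
    and "hd W = 0" "last W = 0"
proof -
  note eq = equal5_sym[OF assms]
  show "runs (subst (mark {j}) W) = 2" if "j \<in> {1..n}"
    using trace_eqD(3)[OF equal5D(1)[OF eq, of "mark {j}"]] runs_mark_U[of "{j}" n] that by simp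
  show single: "runs (map (single_out j) W) = 2" if "j \<in> {1..n}" for j
    using trace_eqD(3)[OF equal5D(2)[OF eq, of "single_out j"]] runs_single_out_U[OF that] by simp
  show "3 \<le> runs (subst (mark {a, b}) W)" if "a \<in> {1..n}" "b \<in> {1..n}" "a \<noteq> b"
    using trace_eqD(2)[OF equal5D(1)[OF eq, of "mark {a, b}"]] runs_mark_U[of "{a, b}" n] that by simp
  have ne: "W \<noteq> []" using equal5_set[OF assms] by (auto simp: set_U)
  have U: "U n \<noteq> []" "hd (U n) = 0" "last (U n) = 0" by (simp_all add: U_def plain_copy_def)
  have "hd W \<noteq> j \<and> last W \<noteq> j" if "j \<in> {1..n}" for j
    using trace_eqD(4,5)[OF equal5D(2)[OF eq, of "single_out j"]] runs_single_out_U[OF that] ne that U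
    by (auto simp: hd_map last_map split: if_splits)
  moreover have "hd W \<in> {0..n}" "last W \<in> {0..n}"
    using ne equal5_set[OF assms] hd_in_set last_in_set by (auto simp: set_U)
  ultimately show "hd W = 0" "last W = 0" by (metis atLeastAtMost_iff gr0_conv_Suc le0 less_one linorder_not_le not_gr0)+
qed

section \<open>The uninterrupted first copy\<close>

text \<open>
  Here \<open>H\<close> is the first copy: it contains every letter of \<open>{1..n}\<close>, and \<open>0\<close> does not
  interrupt it.
\<close>

definition block_form :: "nat \<Rightarrow> nat list \<Rightarrow> nat list \<Rightarrow> nat list \<Rightarrow> bool" where
  "block_form n G H K \<longleftrightarrow> set G \<subseteq> {0} \<and> set H = {1..n} \<and> equal5 (G @ H @ 0 # K) (U n)"

definition U_like :: "nat \<Rightarrow> nat list \<Rightarrow> bool" where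
  "U_like n W \<longleftrightarrow> (\<exists>G H K. W = G @ H @ 0 # K \<and> block_form n G H K)"

text \<open>
  Each letter \<open>j\<close> has two blocks altogether, by the test \<open>single_out j\<close>.  The test \<open>mark {j}\<close>
  also has two blocks; since it sees only one in \<open>H\<close>, the letter \<open>j\<close> occurs in \<open>K\<close> as well.  So
  one block of \<open>j\<close> is in \<open>H\<close> and one in \<open>K\<close>.
\<close>

lemma block_form_runs:
  assumes "block_form n G H K" "j \<in> {1..n}"
  shows "runs (subst (mark {j}) K) = 1" "runs (map (single_out j) H) = 1" "runs (map (single_out j) K) = 1"
    "j \<in> set K"
proof -
  note bf = assms(1)[unfolded block_form_def]
  have "0 \<noteq> j" using assms(2) by auto
  then have "j \<notin> set G" using bf by blast
  have G: "set (subst (mark {j}) G) \<subseteq> {B}" by (rule mark_only_B) (simp add: \<open>j \<notin> set G\<close>)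
  have G': "set (map (single_out j) G) \<subseteq> {B}" using \<open>j \<notin> set G\<close> by auto
  have "0 \<notin> set H" using bf by auto
  then have "runs (subst (mark {j}) H) = 1"
    using bf assms(2) runs_mark_no_zero[of H "{j}"] by auto
  then show K: "runs (subst (mark {j}) K) = 1"
    using equal5_U(1)[of "G @ H @ 0 # K" n j] bf \<open>0 \<noteq> j\<close> assms(2) runs_prefix_B[OF G] by simp
  have "A \<in> set (subst (mark {j}) K)" using K runs_pos[of "subst (mark {j}) K"] by simp
  then show jK: "j \<in> set K" unfolding A_in_mark by simp
  then have "0 < runs (map (single_out j) K)" using runs_pos by force
  moreover have "j \<in> set H" using bf assms(2) by simp
  then have "0 < runs (map (single_out j) H)" using runs_pos by force
  moreover have "runs (map (single_out j) H) + runs (map (single_out j) K) = 2"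
    using equal5_U(2)[of "G @ H @ 0 # K" n j] bf assms(2) runs_prefix_B[OF G'] by simp
  ultimately show "runs (map (single_out j) H) = 1" "runs (map (single_out j) K) = 1" by auto
qed

text \<open>A letter on both sides of the cut would have two blocks in the first copy.\<close>

lemma block_form_cut:
  assumes "block_form n G (H1 @ H2) K" "H1 \<noteq> []" "H2 \<noteq> []" "last H1 \<noteq> hd H2"
  shows "set H1 \<inter> set H2 = {}"
proof -
  have False if "j \<in> set H1" "j \<in> set H2" for j
  proof -
    have "j \<in> {1..n}" using that assms(1) by (auto simp: block_form_def)
    from block_form_runs(2)[OF assms(1) this]
    have "runs (map (single_out j) H1 @ map (single_out j) H2) = 1" by simp
    moreover have "0 < runs (map (single_out j) H1)" "0 < runs (map (single_out j) H2)"
      using that runs_pos by force+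
    ultimately show False
      using runs_append[of "map (single_out j) H1" "map (single_out j) H2"] assms(2-4)
      by (auto simp: hd_map last_map split: if_splits)
  qed
  then show ?thesis by blast
qed

text \<open>
  Each of \<open>a\<close> and \<open>b\<close> has only one block in the word after the first copy.  If these blocks
  were adjacent, the test \<open>mark {a, b}\<close> would have one block in the first copy and one after it,
  while it has at least three.
\<close>

lemma block_form_no_factor:
  assumes bf: "block_form n G H (K1 @ a # b # K2)" and ab: "a \<in> {1..n}" "b \<in> {1..n}" "a \<noteq> b"
  shows False
proof -
  let ?f = "mark {a, b}" and ?K = "K1 @ a # b # K2"
  have a: "runs (map (single_out a) (K1 @ [a])) + runs (map (single_out a) K2) = 1"
    using block_form_runs(3)[OF bf ab(1)] ab(3)
      runs_B(2)[of "map (single_out a) (K1 @ [a])" "map (single_out a) K2"] by simp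
  have b: "runs (map (single_out b) K1) + runs (map (single_out b) (b # K2)) = 1"
    using block_form_runs(3)[OF bf ab(2)] ab(3)
      runs_B(2)[of "map (single_out b) K1" "map (single_out b) (b # K2)"] by simp
  have "0 < runs (map (single_out a) (K1 @ [a]))" "0 < runs (map (single_out b) (b # K2))"
    unfolding runs_pos by auto
  with a b have runs: "runs (map (single_out a) (K1 @ [a])) = 1" "runs (map (single_out b) (b # K2)) = 1"
    "runs (map (single_out a) K2) = 0" "runs (map (single_out b) K1) = 0" by linarith+
  have "a \<notin> set K2" "b \<notin> set K1" using runs(3,4) unfolding runs_eq_0 by force+
  moreover have "0 \<noteq> a" "0 \<noteq> b" using ab by auto
  ultimately have "runs (subst ?f (K1 @ [a])) \<le> runs (map (single_out a) (K1 @ [a]))"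
    "runs (subst ?f (b # K2)) \<le> runs (map (single_out b) (b # K2))"
    by (intro runs_delete; auto simp: mark_def)+
  then have "runs (subst ?f (K1 @ [a])) \<le> 1" "runs (subst ?f (b # K2)) \<le> 1"
    using runs(1,2) by simp_all
  \<comment> \<open>the block that ends in \<open>a\<close> and the block that begins with \<open>b\<close> merge\<close>
  moreover have "runs (subst ?f (K1 @ [a]) @ subst ?f (b # K2)) + 1
      = runs (subst ?f (K1 @ [a])) + runs (subst ?f (b # K2))"
    using runs_append[of "subst ?f (K1 @ [a])" "subst ?f (b # K2)"] by simp
  ultimately have K: "runs (subst ?f ?K) \<le> 1" by simp
  have bfu: "set G \<subseteq> {0}" "set H = {1..n}" "equal5 (G @ H @ 0 # ?K) (U n)"
    using bf by (auto simp: block_form_def)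
  have "set (subst ?f G) \<subseteq> {B}" using bfu(1) ab by (intro mark_only_B) auto
  moreover have "runs (subst ?f H) \<le> 1" using runs_mark_no_zero[of H "{a, b}"] bfu(2) by auto
  ultimately have "runs (subst ?f (G @ H @ 0 # ?K)) \<le> 2"
    using K ab runs_prefix_B[of "subst ?f G" "subst ?f (H @ 0 # ?K)"] by simp
  with equal5_U(3)[OF bfu(3) ab] show False by simp
qed

section \<open>Letters with a cut inside their image\<close>

lemma append_eq_append_Cons:
  "xs @ ys = c @ a # d \<Longrightarrow> a \<notin> set xs \<Longrightarrow> \<exists>c'. ys = c' @ a # d"
proof (induction xs arbitrary: c)
  case (Cons x xs) then show ?case by (cases c) auto
qed auto

text \<open>A cut of an image falls either between the images of letters or inside one of them.\<close>

lemma subst_eq_append: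
  assumes "subst \<theta> u = p @ q"
  shows "(\<exists>u1 u2. u = u1 @ u2 \<and> p = subst \<theta> u1 \<and> q = subst \<theta> u2) \<or>
    (\<exists>u1 t u2 s1 s2. u = u1 @ t # u2 \<and> \<theta> t = s1 @ s2 \<and> s1 \<noteq> [] \<and> s2 \<noteq> [] \<and>
       p = subst \<theta> u1 @ s1 \<and> q = s2 @ subst \<theta> u2)"
  using assms
proof (induction u arbitrary: p)
  case (Cons z u)
  then have "\<theta> z @ subst \<theta> u = p @ q" by simp
  then consider r where "p = \<theta> z @ r" "subst \<theta> u = r @ q"
    | r where "\<theta> z = p @ r" "r \<noteq> []" "q = r @ subst \<theta> u"
    by (auto simp: append_eq_append_conv2) blast+
  then show ?case
  proof cases
    case 1
    from Cons.IH[OF 1(2)] 1(1) show ?thesis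
    proof (elim disjE exE conjE)
      fix u1 u2 assume "u = u1 @ u2" "r = subst \<theta> u1" "q = subst \<theta> u2"
      then show ?thesis using 1(1) by (intro disjI1 exI[of _ "z # u1"] exI[of _ u2]) simp
    next
      fix u1 t u2 s1 s2 assume "u = u1 @ t # u2" "\<theta> t = s1 @ s2" "s1 \<noteq> []" "s2 \<noteq> []"
        "r = subst \<theta> u1 @ s1" "q = s2 @ subst \<theta> u2"
      then show ?thesis using 1(1)
        by (intro disjI2 exI[of _ "z # u1"] exI[of _ t] exI[of _ u2] exI[of _ s1] exI[of _ s2]) simp
    qed
  next
    case 2
    show ?thesis
    proof (cases "p = []")
      case True
      then show ?thesis using 2 by (intro disjI1 exI[of _ "[]"] exI[of _ "z # u"]) simp
    next
      case False
      then show ?thesis using 2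
        by (intro disjI2 exI[of _ "[]"] exI[of _ z] exI[of _ u] exI[of _ p] exI[of _ r]) simp
    qed
  qed
qed simp

lemma hd_subst: "subst \<theta> u \<noteq> [] \<Longrightarrow> \<exists>z\<in>set u. hd (subst \<theta> u) = hd (\<theta> z)"
proof (induction u)
  case (Cons z u) then show ?case by (cases "\<theta> z = []") auto
qed simp

text \<open>
  Pigeonhole: the first occurrence in \<open>H\<close> of each letter \<open>b\<close> other than \<^term>\<open>hd H\<close> gives a cut
  in front of \<open>b\<close>.  If no such cut is inside an image, then every such \<open>b\<close> is the first letter of
  the image of a letter of \<open>u\<close>.
\<close>

lemma cut_inside_image:
  assumes eq: "subst \<theta> u = G @ H @ K" and card: "card (set u) + 2 \<le> card (set H)"
  obtains H1 H2 u1 t u2 s1 s2 where "H = H1 @ H2" "H1 \<noteq> []" "H2 \<noteq> []" "last H1 \<noteq> hd H2"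
    "u = u1 @ t # u2" "\<theta> t = s1 @ s2" "s1 \<noteq> []" "s2 \<noteq> []"
    "G @ H1 = subst \<theta> u1 @ s1" "H2 @ K = s2 @ subst \<theta> u2"
proof (rule ccontr)
  note split = that
  assume contra: "\<not> thesis"
  have "b \<in> (hd \<circ> \<theta>) ` set u" if b: "b \<in> set H - {hd H}" for b
  proof -
    obtain H1 H2 where H: "H = H1 @ b # H2" "b \<notin> set H1" using b split_list_first by fast
    then have H1: "H1 \<noteq> []" using b by auto
    then have "last H1 \<noteq> b" using H(2) last_in_set by metis
    have "subst \<theta> u = (G @ H1) @ (b # H2 @ K)" using eq H by simp
    from subst_eq_append[OF this] show ?thesis
    proof (elim disjE exE conjE)
      fix u1 u2 assume u: "u = u1 @ u2" and eq: "b # H2 @ K = subst \<theta> u2"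
      obtain z where "z \<in> set u2" "b = hd (\<theta> z)"
        using hd_subst[of \<theta> u2, folded eq] by auto
      then show ?thesis using u by auto
    next
      fix u1 t u2 s1 s2 assume "u = u1 @ t # u2" "\<theta> t = s1 @ s2" "s1 \<noteq> []" "s2 \<noteq> []"
        "G @ H1 = subst \<theta> u1 @ s1" "b # H2 @ K = s2 @ subst \<theta> u2"
      then show ?thesis using contra split[of H1 "b # H2" u1 t u2 s1 s2] H H1 \<open>last H1 \<noteq> b\<close> by simp
    qed
  qed
  then have "card (set H - {hd H}) \<le> card ((hd \<circ> \<theta>) ` set u)" by (intro card_mono) auto
  also have "\<dots> \<le> card (set u)" by (simp add: card_image_le)
  finally show False using card by (auto simp: card_Diff_singleton_if split: if_splits)
qed

lemma runs_count: "runs (subst (\<lambda>z. if z = t then [A, B] else []) w) = count_list w t"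
  by (induction w) (auto simp: runs_Cons)

text \<open>Evaluating \<open>t\<close> at \<open>AB\<close> counts its occurrences, and \<open>abab\<close> is not \<open>ab\<close> in \<open>L\<^sub>5\<close>.\<close>

lemma equal5_linear:
  assumes "equal5 u v" "u = u1 @ t # u2" "t \<notin> set u1" "t \<notin> set u2"
  obtains v1 v2 where "v = v1 @ t # v2" "t \<notin> set v1" "t \<notin> set v2"
proof -
  have "count_list u t = 1" using assms by simp
  then have "count_list v t = 1"
    using trace_eqD(3)[OF equal5D(1)[OF assms(1), of "\<lambda>z. if z = t then [A, B] else []"]]
    by (simp add: runs_count)
  moreover from this obtain v1 v2 where "v = v1 @ t # v2"
    by (metis count_notin split_list zero_neq_one)
  ultimately show ?thesis using that by (auto simp: count_list_0_iff)
qed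

text \<open>
  Since \<open>t\<close> occurs once on each side, its image can be chosen independently of the others: \<open>m\<close> is
  inserted between the two parts \<open>s1\<close> and \<open>s2\<close> of the image of \<open>t\<close>.
\<close>

lemma equal5_insert:
  assumes "equal5 (u1 @ t # u2) (v1 @ t # v2)" "t \<notin> set (u1 @ u2)" "t \<notin> set (v1 @ v2)"
  shows "trace (subst g (subst \<theta> u1 @ s1) @ m @ subst g (s2 @ subst \<theta> u2)) =
    trace (subst g (subst \<theta> v1 @ s1) @ m @ subst g (s2 @ subst \<theta> v2))"
proof -
  let ?f = "\<lambda>z. if z = t then subst g s1 @ m @ subst g s2 else subst g (\<theta> z)"
  have "subst ?f w = subst g (subst \<theta> w)" if "t \<notin> set w" for w
    using that by (induction w) auto
  then show ?thesis using equal5D(1)[OF assms(1), of ?f] assms(2,3) by simp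
qed

text \<open>
  Consider a letter \<open>j\<close> of \<open>H1\<close>.  On the left the test \<open>mark {j}\<close> has the form
  \<open>B A \<bar> B A B\<close>, with the marker at the bar, so inserting \<open>AB\<close> creates no new block.  On the
  right the same test also gives \<open>B A B A B\<close>, and the only places where \<open>AB\<close> can be inserted
  without creating a block are the ends of the two blocks.  The marker \<open>B\<close> in the test
  \<open>erase_others j\<close> excludes the second one.  For a letter of \<open>H2\<close> the form is \<open>B \<bar> A B A B\<close>, and
  the marker \<open>BA\<close> plays the role of \<open>AB\<close>.  Thus every letter occurs on its side of the marker
  before any \<open>0\<close> is met, and what precedes the copy consists of \<open>0\<close>s.
\<close>

lemma block_form_marker:
  assumes bf: "block_form n G (H1 @ H2) K" and H: "set H1 \<inter> set H2 = {}"
    and eq: "equal5 (p @ q) (U n)" and pq: "p \<noteq> []" "q \<noteq> []"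
    and marker: "\<And>g m. trace (subst g (G @ H1) @ m @ subst g (H2 @ 0 # K)) =
      trace (subst g p @ m @ subst g q)"
  shows "U_like n (p @ q)"
proof -
  note bfu = bf[unfolded block_form_def]
  have "hd p = 0" "last q = 0" using equal5_U(4,5)[OF eq] pq by simp_all
  then have "0 \<in> set p" "0 \<in> set q" using pq hd_in_set last_in_set by metis+
  \<comment> \<open>these are the last \<open>0\<close> before the marker and the first \<open>0\<close> after it\<close>
  then obtain P Q R S where PQ: "p = P @ 0 # Q" "0 \<notin> set Q" and RS: "q = R @ 0 # S" "0 \<notin> set R"
    by (metis split_list_first split_list_last)
  have "0 \<notin> set (H1 @ H2)" using bfu by (metis atLeastAtMost_iff not_one_le_zero)
  then have no0: "0 \<notin> set H1" "0 \<notin> set H2" by simp_all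
  have set_pq: "set (p @ q) = {0..n}" using equal5_set[OF eq] set_U by simp
  have left: "j \<in> set Q \<and> j \<notin> set P" if j: "j \<in> set H1" for j
  proof -
    let ?m = "subst (mark {j})"
    have jn: "j \<in> {1..n}" "0 \<noteq> j" using j bfu no0 by auto
    have "j \<notin> set G" "j \<notin> set H2" using j jn H bfu by auto
    then have 0: "set (?m G) \<subseteq> {B}" "set (?m H2) \<subseteq> {B}" by (intro mark_only_B; simp)+
    have "set (?m H1) \<subseteq> {A}" using no0(1) by (rule mark_only_A)
    then have "runs (?m (G @ H1) @ [A]) = 1"
      using runs_prefix_B[OF 0(1)] by (simp add: runs_only_A)
    then have "runs (?m (G @ H1) @ [A, B] @ ?m (H2 @ 0 # K)) = 2"
      using runs_B(2)[of "?m (G @ H1) @ [A]"] runs_prefix_B[OF 0(2), of "[]"] block_form_runs(1)[OF bf jn(1)] jn(2)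
      by simp
    then have ins: "runs (?m p @ [A]) + runs (?m q) = 2"
      using trace_eqD(3)[OF marker[of "mark {j}" "[A, B]"]] runs_B(2)[of "?m p @ [A]" "?m q"] by simp
    have "runs (subst (erase_others j) (G @ H1) @ [B] @ subst (erase_others j) (H2 @ 0 # K)) = 2"
      using block_form_runs(4)[OF bf jn(1)]
      by (simp only: append_Cons append_Nil runs_B runs_erase_others) (simp add: j)
    then have "runs (subst (erase_others j) p @ [B] @ subst (erase_others j) q) = 2"
      using trace_eqD(3)[OF marker[of "erase_others j" "[B]"]] by (simp only: order_refl)
    then have "j \<in> set p" "j \<in> set q"
      by (simp_all add: runs_erase_others split: if_splits)
    then have "0 < runs (?m p)" "0 < runs (?m q)" unfolding runs_pos A_in_mark by simp_all
    moreover have "runs (?m p) \<le> runs (?m p @ [A])" by (rule runs_append_le)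
    ultimately have x: "runs (?m p) = 1" "last (?m p) = A"
      using ins runs_snoc_A[of "?m p"] by (simp_all split: if_splits)
    have "?m p = ?m P @ B # ?m Q" using PQ(1) jn by simp
    with x have sum: "runs (?m P) + runs (?m Q) = 1" and "last (B # ?m Q) = A" by simp_all
    from last_Cons_B[OF this(2)] have "0 < runs (?m Q)" "j \<in> set Q"
      unfolding runs_pos A_in_mark by simp_all
    moreover from this sum have "runs (?m P) = 0" by linarith
    then have "j \<notin> set P" unfolding runs_eq_0 A_in_mark by simp
    ultimately show ?thesis by simp
  qed
  have right: "j \<in> set R \<and> j \<notin> set P" if j: "j \<in> set H2" for j
  proof -
    let ?m = "subst (mark {j})"
    have jn: "j \<in> {1..n}" "0 \<noteq> j" using j bfu no0 by auto
    have jGH1: "j \<notin> set (G @ H1)" using j jn H bfu by auto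
    then have 0: "set (?m (G @ H1)) \<subseteq> {B}" by (intro mark_only_B) simp
    have "set (?m H2) \<subseteq> {A}" using no0(2) by (rule mark_only_A)
    then have "runs (A # ?m (H2 @ 0 # K)) = 2"
      using runs_B(2)[of "A # ?m H2"] block_form_runs(1)[OF bf jn(1)] jn(2)
      by (simp add: runs_only_A)
    then have "runs (?m (G @ H1) @ [B, A] @ ?m (H2 @ 0 # K)) = 2"
      by (subst runs_prefix_B[OF 0]) (simp only: append_Cons append_Nil runs_B)
    then have ins: "runs (?m p) + runs (A # ?m q) = 2"
      using trace_eqD(3)[OF marker[of "mark {j}" "[B, A]"]] by simp
    have nil: "subst (erase_others j) (G @ H1) = []" unfolding erase_others_eq_Nil by (fact jGH1)
    have "runs (subst (erase_others j) (H2 @ 0 # K)) \<le> 2" unfolding runs_erase_others by simp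
    then have "hd (subst (erase_others j) p @ [B] @ subst (erase_others j) q) = B"
      using trace_eqD(4)[OF marker[of "erase_others j" "[B]"]]
      by (simp only: nil append_Cons append_Nil runs_B list.sel)
    then have jp: "j \<notin> set p" using hd_erase_others[of j p "subst (erase_others j) q"] by simp
    then have "set (?m p) \<subseteq> {B}" by (intro mark_only_B) simp
    then have "runs (?m p) = 0" "runs (?m q) = 2"
      using equal5_U(1)[OF eq jn(1)] runs_prefix_B[of "?m p" "?m q"] runs_prefix_B[of "?m p" "[]"]
      by simp_all
    with ins have "hd (?m q) = A" by (auto simp: runs_Cons not_B split: if_splits)
    moreover have "?m q = ?m R @ B # ?m S" using RS(1) jn by simp
    ultimately have "hd (?m R @ B # ?m S) = A" by simp
    from hd_append_B[OF this] have "j \<in> set R" unfolding A_in_mark by simp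
    then show ?thesis using jp PQ(1) by simp
  qed
  have H12: "{1..n} = set H1 \<union> set H2" using bfu by auto
  have "set P \<subseteq> {0..n}" using set_pq PQ(1) by auto
  moreover have "set P \<inter> {1..n} = {}" using left right H12 by blast
  moreover have "{0..n} = insert 0 {1..n}" by auto
  ultimately have "set (P @ [0]) \<subseteq> {0}" by auto
  moreover have "set (Q @ R) = {1..n}"
  proof
    have "set (Q @ R) \<subseteq> {0..n} - {0}" using set_pq PQ RS by auto
    then show "set (Q @ R) \<subseteq> {1..n}" by force
    show "{1..n} \<subseteq> set (Q @ R)" unfolding H12 set_append using left right by blast
  qed
  moreover have "p @ q = (P @ [0]) @ (Q @ R) @ 0 # S" using PQ RS by simp
  ultimately show ?thesis unfolding U_like_def block_form_def using eq by metis
qed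

section \<open>Invariance under short identities\<close>

text \<open>
  The letter \<open>t\<close> with a cut of the first copy inside its image occurs once in \<open>u\<close>, hence once
  in \<open>v\<close>.  So the cut reappears in the image of \<open>v\<close> and carries the marker there.
\<close>

lemma U_like_step:
  assumes uv: "equal5 u v" and card: "card (set u) + 2 \<le> n" and like: "U_like n (subst \<theta> u)"
  shows "U_like n (subst \<theta> v)"
proof -
  obtain G H K where W: "subst \<theta> u = G @ H @ 0 # K" and bf: "block_form n G H K"
    using like by (auto simp: U_like_def)
  have "card (set u) + 2 \<le> card (set H)" using card bf by (simp add: block_form_def)
  then obtain H1 H2 u1 t u2 s1 s2 where H: "H = H1 @ H2" "H1 \<noteq> []" "H2 \<noteq> []" "last H1 \<noteq> hd H2"
    and u: "u = u1 @ t # u2" and t: "\<theta> t = s1 @ s2" "s1 \<noteq> []" "s2 \<noteq> []"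
    and p: "G @ H1 = subst \<theta> u1 @ s1" and q: "H2 @ 0 # K = s2 @ subst \<theta> u2"
    by (rule cut_inside_image[OF W])
  have bf': "block_form n G (H1 @ H2) K" using bf H by simp
  have disj: "set H1 \<inter> set H2 = {}" using block_form_cut[OF bf' H(2-4)] .
  define a b where "a = last s1" and "b = hd s2"
  obtain r1 where r1: "s1 = r1 @ [a]" using t(2) a_def by (metis append_butlast_last_id)
  obtain r2 where r2: "s2 = b # r2" using t(3) b_def by (metis list.collapse)
  have "a = last H1" "b = hd H2"
    using arg_cong[OF p, of last] arg_cong[OF q, of hd] H t a_def b_def by simp_all
  then have ab: "a \<in> set H1" "b \<in> set H2" "a \<noteq> b" using H by auto
  then have ab': "a \<in> {1..n}" "b \<in> {1..n}" using bf' by (auto simp: block_form_def)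
  \<comment> \<open>another occurrence of \<open>t\<close> gives another factor \<open>a b\<close>; within the first copy \<open>a\<close> occurs
    only before the cut and \<open>b\<close> only after it, so this factor would lie in \<open>K\<close>\<close>
  have "t \<notin> set u1"
  proof
    assume "t \<in> set u1"
    then have "b \<in> set (G @ H1)" unfolding p using t(1) r2 by force
    then show False using ab disj ab' bf' by (auto simp: block_form_def)
  qed
  moreover have "t \<notin> set u2"
  proof
    assume "t \<in> set u2"
    then obtain w1 w2 where "u2 = w1 @ t # w2" by (meson split_list)
    then have eq: "(H2 @ [0]) @ K = (s2 @ subst \<theta> w1 @ r1) @ a # b # r2 @ subst \<theta> w2"
      using q t(1) r1 r2 by simp
    have "a \<notin> set (H2 @ [0])" using ab ab' disj by auto
    from append_eq_append_Cons[OF eq this] obtain K1 where "K = K1 @ a # b # r2 @ subst \<theta> w2" ..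
    then show False using block_form_no_factor bf ab(3) ab' by blast
  qed
  ultimately obtain v1 v2 where v: "v = v1 @ t # v2" "t \<notin> set v1" "t \<notin> set v2"
    using equal5_linear[OF uv u] by blast
  have "equal5 (subst \<theta> u) (U n)" using W bf by (simp add: block_form_def)
  then have "equal5 (subst \<theta> v) (U n)" using equal5_subst[OF uv] equal5_sym equal5_trans by blast
  then have eq: "equal5 ((subst \<theta> v1 @ s1) @ (s2 @ subst \<theta> v2)) (U n)" using v t by simp
  have "U_like n ((subst \<theta> v1 @ s1) @ (s2 @ subst \<theta> v2))"
  proof (rule block_form_marker[OF bf' disj eq])
    fix g m
    show "trace (subst g (G @ H1) @ m @ subst g (H2 @ 0 # K)) =
      trace (subst g (subst \<theta> v1 @ s1) @ m @ subst g (s2 @ subst \<theta> v2))"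
      unfolding p q using equal5_insert[of u1 t u2 v1 v2 g \<theta> s1 m s2] uv u v
        \<open>t \<notin> set u1\<close> \<open>t \<notin> set u2\<close> by simp
  qed (use t in auto)
  then show ?thesis using v t by simp
qed

text \<open>
  The surrounding words \<open>c\<close> and \<open>d\<close> are images of two new letters, at the two ends of the
  identity.
\<close>

lemma U_like_context:
  assumes uv: "equal5 u v" and len: "length u + 4 \<le> n" and like: "U_like n (c @ subst \<theta> u @ d)"
  shows "U_like n (c @ subst \<theta> v @ d)"
proof -
  obtain x where x: "x \<notin> set (u @ v)" using ex_new_if_finite[of "set (u @ v)"] by auto
  obtain y where y: "y \<notin> insert x (set (u @ v))"
    using ex_new_if_finite[of "insert x (set (u @ v))"] by auto
  let ?\<theta> = "\<theta>(x := c, y := d)"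
  have "subst ?\<theta> w = subst \<theta> w" if "set w \<subseteq> set (u @ v)" for w
    using that x y by (intro arg_cong[of _ _ concat] map_cong) auto
  then have "subst ?\<theta> u = subst \<theta> u" "subst ?\<theta> v = subst \<theta> v" by auto
  then have ext: "subst ?\<theta> ([x] @ u @ [y]) = c @ subst \<theta> u @ d"
    "subst ?\<theta> ([x] @ v @ [y]) = c @ subst \<theta> v @ d"
    using y by auto
  have "card (set ([x] @ u @ [y])) \<le> length ([x] @ u @ [y])" by (rule card_length)
  then have "card (set ([x] @ u @ [y])) + 2 \<le> n" using len by simp
  from U_like_step[OF equal5_context[OF uv] this, of ?\<theta>] show ?thesis
    using like by (simp only: ext)
qed

text \<open>
  Quantifying over substitutions and contexts makes the equivalence closed under the rules of
  deduction.
\<close>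

lemma U_like_deducible:
  assumes "deducible \<Sigma> u v"
    and \<Sigma>: "\<And>p q. (p, q) \<in> \<Sigma> \<Longrightarrow> equal5 p q \<and> length p + 4 \<le> n \<and> length q + 4 \<le> n"
  shows "U_like n (c @ subst \<theta> u @ d) \<longleftrightarrow> U_like n (c @ subst \<theta> v @ d)"
  using assms(1)
proof (induction arbitrary: c \<theta> d)
  case (axiom u v)
  then show ?case using \<Sigma> U_like_context equal5_sym by meson
next
  case (mult u v u' v')
  show ?case
    using mult.IH(1)[of c \<theta> "subst \<theta> u' @ d"] mult.IH(2)[of "c @ subst \<theta> v" \<theta> d] by simp
next
  case (subst u v \<eta>)
  then show ?case by (simp add: subst_subst)
qed auto

lemma U_like_U: assumes "0 < n" shows "U_like n (U n)"
proof -
  have "[1..<Suc n] = 1 # [2..<Suc n]" using assms upt_conv_Cons[of 1 "Suc n"]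
    by (simp add: numeral_2_eq_2 del: upt_Suc)
  then have "U n = [0] @ [1..<Suc n] @ 0 # ([1] @ spaced_copy [2..<Suc n] @ [0])"
    by (simp add: U_def plain_copy_def spaced_copy_def del: upt_Suc)
  moreover from this have "block_form n [0] [1..<Suc n] ([1] @ spaced_copy [2..<Suc n] @ [0])"
    by (auto simp: block_form_def equal5_def simp del: upt_Suc)
  ultimately show ?thesis unfolding U_like_def by blast
qed

lemma not_U_like_V: assumes "2 \<le> n" shows "\<not> U_like n (V n)"
proof
  assume "U_like n (V n)"
  then obtain G H K where V: "V n = G @ H @ 0 # K" and GH: "set G \<subseteq> {0}" "set H = {1..n}"
    by (auto simp: U_like_def block_form_def)
  have "[1..<Suc n] = 1 # 2 # [3..<Suc n]"
    using assms upt_conv_Cons[of 1 "Suc n"] upt_conv_Cons[of 2 "Suc n"]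
    by (simp add: numeral_2_eq_2 numeral_3_eq_3 del: upt_Suc)
  then obtain r where "V n = 0 # 1 # 0 # r" by (simp add: V_def spaced_copy_def del: upt_Suc)
  with V have eq: "G @ H @ 0 # K = 0 # 1 # 0 # r" by simp
  have H: "1 \<in> set H" "2 \<in> set H" "0 \<notin> set H" using GH assms by auto
  then show False using eq GH(1)
    by (auto simp: append_eq_Cons_conv)
qed

theorem corollary2p5:
  fixes M :: "('a, 'm) monoid_scheme"
  assumes "monoid M"
    and "\<exists>l\<ge>5. M \<in> var (L1 l)"
    and "L1 5 \<in> var M"
  shows "\<not> finitely_based M"
proof
  assume "finitely_based M"
  then obtain \<Sigma> where \<Sigma>: "\<Sigma> \<subseteq> identities_of M" "finite \<Sigma>"
    and ded: "\<And>u v. (u, v) \<in> identities_of M \<Longrightarrow> deducible \<Sigma> u v"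
    unfolding finitely_based_def by blast
  have sg: "is_semigroup M" using assms(1) by (rule monoid_is_semigroup)
  \<comment> \<open>the pigeonhole argument needs \<open>n\<close> to exceed the number of letters by \<open>2\<close>, and the context
    adds two letters\<close>
  define n where "n = (\<Sum>(p, q)\<in>\<Sigma>. length p + length q) + 4"
  have n: "2 \<le> n" by (simp add: n_def)
  have ax: "equal5 p q \<and> length p + 4 \<le> n \<and> length q + 4 \<le> n" if pq: "(p, q) \<in> \<Sigma>" for p q
  proof -
    have id: "{(p, q)} \<subseteq> identities" "satisfies M (p, q)"
      using pq \<Sigma> by (auto simp: identities_of_def)
    then have "M \<in> equational_class {(p, q)}" using sg by (simp add: equational_class_def)
    then have "L1 5 \<in> equational_class {(p, q)}" using assms(3) id(1) unfolding var_def by blast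
    then have "equal5 p q"
      using id(1) by (intro satisfies_L1_5_imp_equal5) (auto simp: equational_class_def identities_def)
    moreover have "length p + length q \<le> n - 4"
      using member_le_sum[of "(p, q)" \<Sigma> "\<lambda>(p, q). length p + length q"] pq \<Sigma>(2) by (auto simp: n_def)
    ultimately show ?thesis using n by (auto simp: n_def)
  qed
  obtain l where l: "5 \<le> l" "M \<in> var (L1 l)" using assms(2) by blast
  have UV: "{(U n, V n)} \<subseteq> identities" by (auto simp: identities_def U_def V_def)
  moreover have "L1 l \<in> equational_class {(U n, V n)}"
    using L1_satisfies_U_V[of l n] monoid_is_semigroup[OF monoid_L1[of l]] l(1) n
    by (simp add: equational_class_def)
  ultimately have "M \<in> equational_class {(U n, V n)}" using l(2) unfolding var_def by blast
  then have "deducible \<Sigma> (U n) (V n)"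
    using UV by (intro ded) (auto simp: identities_of_def equational_class_def)
  from U_like_deducible[OF this, where n = n and c = "[]" and d = "[]" and \<theta> = "\<lambda>z. [z]"]
  have "U_like n (U n) \<longleftrightarrow> U_like n (V n)" using ax by simp
  then show False using U_like_U[of n] not_U_like_V[of n] n by simp
qed

end
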